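(* Let $R\in\mathbb{R}^{N\times d}$ be a real matrix with singular value decomposition $R=U\Sigma V^T$, where $\Sigma=\mathrm{diag}(\sigma_1,\sigma_2,\dots,\sigma_k)$ with $\sigma_1\ge\sigma_2\ge\dots\ge\sigma_k\ge 0$. Let $\Sigma'=\mathrm{diag}(\sigma_1,0,\dots,0)$ (of the same size as $\Sigma$) and $\bar R=U\Sigma'V^T$. Let $\eta$ be a real number with $0<\eta<0.5$, and define a sequence of matrices by $R^{(0)}=R$ and $$R^{(n+1)}=R^{(n)}+2\eta\,(\bar R-R^{(n)}),\qquad n\ge 0.$$ Then the sequence converges to the fixed point $\bar R$: $$\lim_{n\to\infty}R^{(n)}=\bar R .$$
   Context: The singular value decomposition is in the usual sense, with singular values listed in descending order: $k=\min(N,d)$, $U\in\mathbb{R}^{N\times k}$ and $V\in\mathbb{R}^{d\times k}$ have orthonormal columns, and $\Sigma$ is the $k\times k$ diagonal matrix of singular values. The recursion is gradient descent with learning rate $\eta$ for the low-rank loss $f(R)=\|\bar R-R\|_F^2$ ($\|\cdot\|_F$ the Frobenius norm), where $\bar R$ is treated as a constant when differentiating, so that $\nabla f(R)=-2(\bar R-R)$. *)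

theory Defs
  imports "HOL-Analysis.Analysis"
begin

(* Matrices of size N x d are of type real^'d^'N. On this type the library norm is the
   Frobenius norm, and convergence is convergence in that norm. *)

definition diag_matrix :: "real^'k \<Rightarrow> real^'k^'k" where
  "diag_matrix s = (\<chi> i j. if i = j then s $ i else 0)"

definition orthonormal_columns :: "real^'k^'m \<Rightarrow> bool" where
  "orthonormal_columns A \<longleftrightarrow>
     (\<forall>i j. column i A \<bullet> column j A = (if i = j then 1 else 0))"

(* The index type 'k of the singular values is linearly ordered, so that it stands for
   {1, ..., k} with k = min N d; the constraint on CARD('k) is what fixes k. *)
definition is_svd ::
  "real^'d^'N \<Rightarrow> real^'k::{finite,linorder}^'N \<Rightarrow> real^'k::{finite,linorder} \<Rightarrow>
   real^'k::{finite,linorder}^'d \<Rightarrow> bool" where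
  "is_svd R U s V \<longleftrightarrow>
     CARD('k) = min CARD('N) CARD('d) \<and>
     orthonormal_columns U \<and> orthonormal_columns V \<and>
     (\<forall>i j. i \<le> j \<longrightarrow> s $ j \<le> s $ i) \<and> (\<forall>i. 0 \<le> s $ i) \<and>
     R = U ** diag_matrix s ** transpose V"

(* Min UNIV is the first index, so this turns (s_1, ..., s_k) into (s_1, 0, ..., 0). *)
definition keep_first :: "real^'k::{finite,linorder} \<Rightarrow> real^'k::{finite,linorder}" where
  "keep_first s = (\<chi> i. if i = Min UNIV then s $ i else 0)"

end

theory Submission
  imports Defs
begin

text \<open>Measured from the fixed target, each step of the recursion only rescales the error:
  \<open>x (Suc n) - a = (1 - c) *\<^sub>R (x n - a)\<close>. The error is thus a geometric sequence
  with ratio \<open>1 - c\<close> and vanishes when that ratio has modulus below 1. The argument is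
  linear, so it is carried out in any real normed space and then applied to matrices with the
  Frobenius norm.\<close>

lemma affine_recursion_tendsto_fixpoint:
  fixes x :: "nat \<Rightarrow> 'a::real_normed_vector"
  assumes step: "\<And>n. x (Suc n) = x n + c *\<^sub>R (a - x n)"
    and c: "\<bar>1 - c\<bar> < 1"
  shows "x \<longlonglongrightarrow> a"
proof -
  have err: "x n = a + (1 - c) ^ n *\<^sub>R (x 0 - a)" for n
  proof (induction n)
    case (Suc n)
    have "x (Suc n) = a + (1 - c) *\<^sub>R (x n - a)"
      by (simp add: step algebra_simps)
    also have "x n - a = (1 - c) ^ n *\<^sub>R (x 0 - a)"
      using Suc.IH by (metis add_diff_cancel_left')
    finally show ?case
      by simp
  qed simp
  have "(\<lambda>n. (1 - c) ^ n) \<longlonglongrightarrow> 0"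
    using c by (intro LIMSEQ_power_zero) simp
  then have "(\<lambda>n. a + (1 - c) ^ n *\<^sub>R (x 0 - a)) \<longlonglongrightarrow> a + 0 *\<^sub>R (x 0 - a)"
    by (intro tendsto_add tendsto_scaleR tendsto_const)
  then show ?thesis
    by (simp flip: err)
qed

theorem theorem2:
  fixes R Rbar :: "real^'d^'N"
    and U :: "real^'k::{finite,linorder}^'N"
    and V :: "real^'k::{finite,linorder}^'d"
    and \<sigma> :: "real^'k::{finite,linorder}"
    and \<eta> :: real
    and S :: "nat \<Rightarrow> real^'d^'N"
  assumes "is_svd R U \<sigma> V"
    and "Rbar = U ** diag_matrix (keep_first \<sigma>) ** transpose V"
    and "0 < \<eta>" and "\<eta> < 0.5"
    and "S 0 = R"
    and "\<And>n. S (Suc n) = S n + (2 * \<eta>) *\<^sub>R (Rbar - S n)"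
  shows "S \<longlonglongrightarrow> Rbar \<and> Rbar + (2 * \<eta>) *\<^sub>R (Rbar - Rbar) = Rbar"
proof
  \<comment> \<open>Here \<open>c = 2 * \<eta>\<close> lies strictly between 0 and 1, so the
    contraction ratio \<open>1 - 2 * \<eta>\<close> does too.\<close>
  show "S \<longlonglongrightarrow> Rbar"
    using assms(3,4,6) by (intro affine_recursion_tendsto_fixpoint[of S "2 * \<eta>"]) auto
\<comment> \<open>At \<open>Rbar\<close> the gradient term vanishes, so the update leaves it
  fixed.\<close>
qed simp

end
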